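(* $\mathrm{MITL}[F,P]\not\subseteq\mathrm{BMTL}[U,S]$: there is an MITL$[F,P]$ formula $\phi$ such that no BMTL$[U,S]$ formula $\psi$ satisfies $\mathcal{L}(\psi)=\mathcal{L}(\phi)$.
   Context: Fix a finite alphabet $\Sigma$. A timed word is $\rho=(\sigma_1,\tau_1)\cdots(\sigma_n,\tau_n)$, $n\ge1$, $\sigma_i\in\Sigma$, $\tau_i\in\mathbb{R}_{\ge0}$, $\tau_1=0$, $\tau_i\le\tau_{i+1}$. An interval is a convex subset of $\mathbb{R}_{\ge0}$ with endpoints non-negative integers or $\infty$ (finite ends open or closed); it is singular if of the form $[c,c]$, bounded if it does not extend to $\infty$. MTL$[U,S]$ formulas: $\phi::=a\mid\phi\wedge\phi\mid\neg\phi\mid\phi U_I\phi\mid\phi S_I\phi$ ($a\in\Sigma$, $I$ an interval), with strict semantics: $\rho,i\models\phi_1U_I\phi_2$ iff $\exists j>i$: $\rho,j\models\phi_2$, $\tau_j-\tau_i\in I$, $\forall i<k<j$: $\rho,k\models\phi_1$; $\rho,i\models\phi_1S_I\phi_2$ iff $\exists j<i$: $\rho,j\models\phi_2$, $\tau_i-\tau_j\in I$, $\forall j<k<i$: $\rho,k\models\phi_1$; $\rho,i\models a$ iff $\sigma_i=a$; Booleans as usual. $F_I\phi:=\top U_I\phi$, $P_I\phi:=\top S_I\phi$. $\mathcal{L}(\phi)=\{\rho:\rho,1\models\phi\}$. MITL$[U,S]$ allows only non-singular intervals, BMTL$[U,S]$ only bounded intervals; MITL$[F,P]$ is the fragment of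 MITL$[U,S]$ using only the modalities $F_I,P_I$. *)

theory Defs
  imports Complex_Main
begin

text \<open>
  Finite alphabets are types of class \<open>finite\<close>. Types are nonempty, and so is every alphabet
  that admits a timed word.
\<close>

definition timed_word :: "('a \<times> real) list \<Rightarrow> bool" where
  "timed_word \<rho> \<longleftrightarrow>
     \<rho> \<noteq> [] \<and> (\<forall>t \<in> set (map snd \<rho>). 0 \<le> t) \<and> snd (\<rho> ! 0) = 0 \<and> sorted (map snd \<rho>)"

text \<open>
  The endpoints are not required to be ordered, so the empty set is an interval. It is bounded and
  not singular, and a modality carrying it is unsatisfiable.
\<close>

typedef interval =
  "{I :: real set.
      (\<exists>l u :: nat. I = {real l..real u} \<or> I = {real l..<real u} \<or>
                     I = {real l<..real u} \<or> I = {real l<..<real u}) \<or>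
      (\<exists>l :: nat. I = {real l..} \<or> I = {real l<..})}"
  morphisms set_of_interval Interval
  by blast

definition singular :: "interval \<Rightarrow> bool" where
  "singular I \<longleftrightarrow> (\<exists>c :: nat. set_of_interval I = {real c..real c})"

definition bounded_interval :: "interval \<Rightarrow> bool" where
  "bounded_interval I \<longleftrightarrow> bdd_above (set_of_interval I)"

datatype 'a mtl =
    Atom 'a
  | Conj "'a mtl" "'a mtl"
  | Neg "'a mtl"
  | Until "'a mtl" interval "'a mtl"
  | Since "'a mtl" interval "'a mtl"

text \<open>The grammar has no primitive truth constant; which letter is used here is immaterial.\<close>

definition Top :: "'a mtl" where
  "Top = Neg (Conj (Atom undefined) (Neg (Atom undefined)))"

definition Future :: "interval \<Rightarrow> 'a mtl \<Rightarrow> 'a mtl" where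
  "Future I \<phi> = Until Top I \<phi>"

definition Past :: "interval \<Rightarrow> 'a mtl \<Rightarrow> 'a mtl" where
  "Past I \<phi> = Since Top I \<phi>"

text \<open>Positions are counted from 0, so the first position of a word is 0.\<close>

primrec sat :: "('a \<times> real) list \<Rightarrow> nat \<Rightarrow> 'a mtl \<Rightarrow> bool" where
  "sat \<rho> i (Atom a) \<longleftrightarrow> fst (\<rho> ! i) = a"
| "sat \<rho> i (Conj \<phi> \<psi>) \<longleftrightarrow> sat \<rho> i \<phi> \<and> sat \<rho> i \<psi>"
| "sat \<rho> i (Neg \<phi>) \<longleftrightarrow> \<not> sat \<rho> i \<phi>"
| "sat \<rho> i (Until \<phi> I \<psi>) \<longleftrightarrow>
     (\<exists>j. i < j \<and> j < length \<rho> \<and> sat \<rho> j \<psi> \<and> snd (\<rho> ! j) - snd (\<rho> ! i) \<in> set_of_interval I \<and>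
          (\<forall>k. i < k \<and> k < j \<longrightarrow> sat \<rho> k \<phi>))"
| "sat \<rho> i (Since \<phi> I \<psi>) \<longleftrightarrow>
     (\<exists>j. j < i \<and> sat \<rho> j \<psi> \<and> snd (\<rho> ! i) - snd (\<rho> ! j) \<in> set_of_interval I \<and>
          (\<forall>k. j < k \<and> k < i \<longrightarrow> sat \<rho> k \<phi>))"

definition language :: "'a mtl \<Rightarrow> ('a \<times> real) list set" where
  "language \<phi> = {\<rho>. timed_word \<rho> \<and> sat \<rho> 0 \<phi>}"

primrec intervals :: "'a mtl \<Rightarrow> interval set" where
  "intervals (Atom a) = {}"
| "intervals (Conj \<phi> \<psi>) = intervals \<phi> \<union> intervals \<psi>"
| "intervals (Neg \<phi>) = intervals \<phi>"
| "intervals (Until \<phi> I \<psi>) = insert I (intervals \<phi> \<union> intervals \<psi>)"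
| "intervals (Since \<phi> I \<psi>) = insert I (intervals \<phi> \<union> intervals \<psi>)"

definition MITL_US :: "'a mtl set" where
  "MITL_US = {\<phi>. \<forall>I \<in> intervals \<phi>. \<not> singular I}"

definition BMTL_US :: "'a mtl set" where
  "BMTL_US = {\<phi>. \<forall>I \<in> intervals \<phi>. bounded_interval I}"

inductive_set MTL_FP :: "'a mtl set" where
  "Atom a \<in> MTL_FP"
| "\<phi> \<in> MTL_FP \<Longrightarrow> \<psi> \<in> MTL_FP \<Longrightarrow> Conj \<phi> \<psi> \<in> MTL_FP"
| "\<phi> \<in> MTL_FP \<Longrightarrow> Neg \<phi> \<in> MTL_FP"
| "\<phi> \<in> MTL_FP \<Longrightarrow> Future I \<phi> \<in> MTL_FP"
| "\<phi> \<in> MTL_FP \<Longrightarrow> Past I \<phi> \<in> MTL_FP"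

definition MITL_FP :: "'a mtl set" where
  "MITL_FP = MITL_US \<inter> MTL_FP"

end

theory Submission
  imports Defs
begin

text \<open>
  The formula \<open>F\<^bsub>[0,\<infinity>)\<^esub> \<top>\<close> says that there is a second position. If that position lies
  beyond all endpoints occurring in a bounded formula, the formula, evaluated at the first
  position, cannot tell whether it is there. This needs only one letter.
\<close>

text \<open>For large \<open>t\<close>, \<open>Until\<close> and \<open>Since\<close> both fail at
  position 0 of either word, whatever their arguments are. So the induction needs no claim about
  position 1. The threshold for \<open>t\<close> depends on \<open>\<psi>\<close>; the filter merges
  the two thresholds for \<open>Conj\<close>.\<close>

lemma bounded_sat_far_event:
  assumes "\<forall>I \<in> intervals \<psi>. bounded_interval I"
  shows "\<forall>\<^sub>F t in at_top. sat [(a, s), (b, t)] 0 \<psi> \<longleftrightarrow> sat [(a, s)] 0 \<psi>"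
  using assms
proof (induction \<psi>)
  case (Conj \<psi>1 \<psi>2)
  then have "\<forall>\<^sub>F t in at_top. sat [(a, s), (b, t)] 0 \<psi>1 \<longleftrightarrow> sat [(a, s)] 0 \<psi>1"
    and "\<forall>\<^sub>F t in at_top. sat [(a, s), (b, t)] 0 \<psi>2 \<longleftrightarrow> sat [(a, s)] 0 \<psi>2"
    by simp_all
  then show ?case
    by eventually_elim simp
next
  case (Until \<psi>1 I \<psi>2)
  then obtain M where M: "\<And>x. x \<in> set_of_interval I \<Longrightarrow> x \<le> M"
    by (auto simp: bounded_interval_def bdd_above_def)
  \<comment> \<open>Then position 1, the only candidate witness for \<open>Until\<close>, is more
    than \<open>M\<close> away from position 0; the one-letter word has no candidate at all.\<close>
  have "\<forall>\<^sub>F t in at_top. M + s < t"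
    by (rule eventually_gt_at_top)
  then show ?case
  proof eventually_elim
    case (elim t)
    then have "t - s \<notin> set_of_interval I"
      using M[of "t - s"] by auto
    then show ?case
      by (auto simp: less_Suc_eq)
  qed
\<comment> \<open>\<open>Since\<close> is false at position 0, as nothing precedes it.\<close>
qed simp_all

lemma sat_Top [simp]: "sat \<rho> i Top"
  by (simp add: Top_def)

lemma Top_in_MTL_FP: "Top \<in> MTL_FP"
  unfolding Top_def by (intro MTL_FP.intros)

lemma set_of_interval_atLeast [simp]:
  "set_of_interval (Interval {real l..}) = {real l..}"
  by (rule Interval_inverse) blast

text \<open>The reals have no greatest element, so a half-line is never of the form
  \<open>{l..h}\<close>.\<close>

lemma not_singular_atLeast: "\<not> singular (Interval {real l..})"
  unfolding singular_def by (simp add: not_Ici_eq_Icc del: atLeastAtMost_singleton)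

theorem theorem2:
  shows "\<exists>\<phi> :: ('a::finite) mtl. \<phi> \<in> MITL_FP \<and>
           \<not> (\<exists>\<psi> :: 'a mtl. \<psi> \<in> BMTL_US \<and> language \<psi> = language \<phi>)"
proof (intro exI conjI notI)
  let ?\<phi> = "Future (Interval {real 0..}) Top :: 'a mtl"
  have "intervals ?\<phi> = {Interval {real 0..}}"
    by (simp add: Future_def Top_def)
  then show "?\<phi> \<in> MITL_FP"
    using not_singular_atLeast[of 0] MTL_FP.intros(4)[OF Top_in_MTL_FP]
    by (simp add: MITL_FP_def MITL_US_def del: of_nat_0)
  assume "\<exists>\<psi> :: 'a mtl. \<psi> \<in> BMTL_US \<and> language \<psi> = language ?\<phi>"
  then obtain \<psi> :: "'a mtl" where \<psi>: "\<psi> \<in> BMTL_US" and eq: "language \<psi> = language ?\<phi>"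
    by blast
  fix a :: 'a
  \<comment> \<open>The conjunct \<open>0 \<le> t\<close> makes the longer word a timed word and
    puts its second position within reach of \<open>[0,\<infinity>)\<close>.\<close>
  have "\<forall>\<^sub>F t in at_top. (sat [(a, 0), (a, t)] 0 \<psi> \<longleftrightarrow> sat [(a, 0)] 0 \<psi>) \<and> 0 \<le> t"
    using \<psi> by (intro eventually_conj bounded_sat_far_event eventually_ge_at_top)
      (simp add: BMTL_US_def)
  then obtain t where t: "sat [(a, 0), (a, t)] 0 \<psi> \<longleftrightarrow> sat [(a, 0)] 0 \<psi>" "0 \<le> t"
    by (auto dest: eventually_happens)
  have words: "timed_word [(a, 0)]" "timed_word [(a, 0), (a, t)]"
    using t(2) by (simp_all add: timed_word_def)
  have "[(a, 0), (a, t)] \<in> language ?\<phi>"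
    using words t(2) set_of_interval_atLeast[of 0]
    by (auto simp: language_def Future_def intro!: exI[of _ 1])
  moreover have "[(a, 0)] \<notin> language ?\<phi>"
    by (simp add: language_def Future_def)
  ultimately show False
    using t(1) words unfolding eq[symmetric] by (simp add: language_def)
qed

end
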